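(* Let $m,n$ be positive integers. Any graph $G\in G_{m,n}$ is connected.
   Context: All graphs are finite and simple. For positive integers $m,n$, $G_{m,n}$ denotes the class of all simple graphs that have the same degree sequence as the disjoint union $K_m\cup K_n$ of two cliques (that is, $m$ vertices of degree $m-1$ and $n$ further vertices of degree $n-1$) but are not isomorphic to $K_m\cup K_n$. *)

theory Defs
  imports "Graph_Theory.Graph_Theory" "HOL-Library.Multiset"
begin

text \<open>
  A finite simple graph is an instance of the locale \<^locale>\<open>graph\<close>: every undirected edge is a
  pair of opposite arcs. The degree of a vertex is therefore its out-degree (equally its
  in-degree); the sum of the two would count each edge twice.
\<close>

definition degree_sequence :: "('a, 'b) pre_digraph \<Rightarrow> nat list" where
  "degree_sequence G =
     rev (sorted_list_of_multiset (image_mset (out_degree G) (mset_set (verts G))))"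

definition complete_graph :: "nat \<Rightarrow> (nat, nat \<times> nat) pre_digraph" where
  "complete_graph n =
     with_proj \<lparr>pverts = {..<n}, parcs = {(u, v). u < n \<and> v < n \<and> u \<noteq> v}\<rparr>"

definition disjoint_union ::
    "('a, 'b) pre_digraph \<Rightarrow> ('c, 'd) pre_digraph \<Rightarrow> ('a + 'c, 'b + 'd) pre_digraph" where
  "disjoint_union G H =
     \<lparr>verts = verts G <+> verts H, arcs = arcs G <+> arcs H,
      tail = map_sum (tail G) (tail H), head = map_sum (head G) (head H)\<rparr>"

definition two_cliques :: "nat \<Rightarrow> nat \<Rightarrow> (nat + nat, nat \<times> nat + nat \<times> nat) pre_digraph" where
  "two_cliques m n = disjoint_union (complete_graph m) (complete_graph n)"

definition degree_class :: "nat \<Rightarrow> nat \<Rightarrow> ('a, 'b) pre_digraph set" where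
  "degree_class m n =
     {G. graph G \<and> degree_sequence G = degree_sequence (two_cliques m n)
       \<and> \<not> digraph_iso G (two_cliques m n)}"

lemma complete_digraph_complete_graph: "K\<^bsub>n\<^esub> (complete_graph n)"
  unfolding complete_graph_def complete_digraph_pair_def by auto

lemma graph_disjoint_union:
  assumes "graph G" "graph H"
  shows "graph (disjoint_union G H)"
proof -
  interpret G: graph G by fact
  interpret H: graph H by fact
  show ?thesis
  proof
    show "symmetric (disjoint_union G H)"
      using G.sym_arcs H.sym_arcs unfolding symmetric_conv disjoint_union_def
      by (simp add: Plus_def ball_Un bex_Un)
  qed (use G.no_multi_arcs H.no_multi_arcs in
        \<open>auto simp: disjoint_union_def arc_to_ends_def dest: G.no_loops H.no_loops\<close>)
qed

lemma graph_two_cliques: "graph (two_cliques m n)"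
  unfolding two_cliques_def
  using complete_digraph_complete_graph by (auto simp: complete_digraph_def intro: graph_disjoint_union)

lemma out_degree_complete_graph:
  assumes "v < n"
  shows "out_degree (complete_graph n) v = n - 1"
proof -
  have "out_arcs (complete_graph n) v = Pair v ` ({..<n} - {v})"
    using assms by (auto simp: out_arcs_def complete_graph_def)
  then show ?thesis
    using assms by (simp add: out_degree_def card_image inj_on_def)
qed

lemma out_degree_disjoint_union:
  "out_degree (disjoint_union G H) (Inl u) = out_degree G u"
  "out_degree (disjoint_union G H) (Inr v) = out_degree H v"
proof -
  have "out_arcs (disjoint_union G H) (Inl u) = Inl ` out_arcs G u"
    "out_arcs (disjoint_union G H) (Inr v) = Inr ` out_arcs H v"
    by (auto simp: out_arcs_def disjoint_union_def)
  then show "out_degree (disjoint_union G H) (Inl u) = out_degree G u"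
    "out_degree (disjoint_union G H) (Inr v) = out_degree H v"
    by (simp_all add: out_degree_def card_image)
qed

lemma mset_degree_sequence_two_cliques:
  "mset (degree_sequence (two_cliques m n)) = replicate_mset m (m - 1) + replicate_mset n (n - 1)"
proof -
  have v: "verts (two_cliques m n) = Inl ` {..<m} \<union> Inr ` {..<n}"
    by (simp add: two_cliques_def disjoint_union_def complete_graph_def Plus_def)
  have "mset_set (verts (two_cliques m n)) =
      image_mset Inl (mset_set {..<m}) + image_mset Inr (mset_set {..<n})"
    unfolding v by (subst mset_set_Union) (auto simp: image_mset_mset_set)
  moreover have "image_mset (\<lambda>u. out_degree (complete_graph k) u) (mset_set {..<k}) =
      replicate_mset k (k - 1)" for k
  proof -
    have "image_mset (\<lambda>u. out_degree (complete_graph k) u) (mset_set {..<k}) =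
        image_mset (\<lambda>_. k - 1) (mset_set {..<k})"
      by (rule image_mset_cong) (simp add: out_degree_complete_graph)
    then show ?thesis by (simp add: image_mset_const_eq)
  qed
  ultimately show ?thesis
    by (simp add: degree_sequence_def two_cliques_def out_degree_disjoint_union multiset.map_comp
        comp_def)
qed

end

theory Submission
  imports Defs
begin

text \<open>
  Why disconnectedness forces the two cliques: in a simple graph a vertex of degree \<open>d\<close> has a
  closed neighbourhood of \<open>d + 1\<close> vertices, and a set of vertices that no edge leaves contains the
  closed neighbourhood of each of its members, so it has at least \<open>d + 1\<close> members.

  Write \<open>M\<close> and \<open>N\<close> for the larger and the smaller of the two clique sizes, and suppose that the
  graph is not connected. Let \<open>A\<close> be the component of some vertex of degree \<open>M - 1\<close> and \<open>B\<close> the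
  nonempty rest. Then \<open>A\<close> has at least \<open>M\<close> vertices and, as all degrees are at least \<open>N - 1\<close>, \<open>B\<close>
  has at least \<open>N\<close>; there are only \<open>M + N\<close> vertices, so both bounds are attained. Now no vertex
  of \<open>B\<close> has degree above \<open>N - 1\<close>, so all have exactly this degree, which leaves degree \<open>M - 1\<close> for
  every vertex of \<open>A\<close> (\<open>two_part_degrees\<close>). Thus every closed neighbourhood is all of \<open>A\<close> or all
  of \<open>B\<close>, that is, the graph is a disjoint union of two cliques of the given sizes, and
  \<open>two_cliques_iso\<close> contradicts the membership in the degree class.
\<close>

section \<open>Closed neighbourhoods and the degree count\<close>

definition closed_nbhd :: "('a, 'b) pre_digraph \<Rightarrow> 'a \<Rightarrow> 'a set" where
  "closed_nbhd G u = insert u {v. u \<rightarrow>\<^bsub>G\<^esub> v}"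

lemma (in digraph) card_closed_nbhd: "card (closed_nbhd G u) = Suc (out_degree G u)"
proof -
  have "{v. u \<rightarrow>\<^bsub>G\<^esub> v} = head G ` out_arcs G u"
    by (auto simp: arcs_ends_conv)
  moreover have "inj_on (head G) (out_arcs G u)"
    by (auto intro!: inj_onI no_multi_arcs simp: arc_to_ends_def)
  ultimately have "card {v. u \<rightarrow>\<^bsub>G\<^esub> v} = out_degree G u" "finite {v. u \<rightarrow>\<^bsub>G\<^esub> v}"
    by (simp_all add: out_degree_def card_image finite_out_arcs)
  moreover have "u \<notin> {v. u \<rightarrow>\<^bsub>G\<^esub> v}"
    using adj_not_same by blast
  ultimately show ?thesis
    by (simp add: closed_nbhd_def)
qed

text \<open>
  The arithmetic of the degree sequence. The inequalities \<open>Suc (d u) \<le> card A\<close> and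
  \<open>Suc (d u) \<le> card B\<close> are what closed neighbourhoods inside \<open>A\<close> and \<open>B\<close> give. The order of the
  steps matters: with the part sizes known, the bounds pin the degrees in \<open>B\<close> from both sides but
  in \<open>A\<close>, when \<open>N < M\<close>, only from above; the degrees in \<open>A\<close> are what is left of the multiset
  after cancelling those of \<open>B\<close>.
\<close>

lemma two_part_degrees:
  fixes d :: "'a \<Rightarrow> nat"
  assumes fin: "finite A" "finite B" and disj: "A \<inter> B = {}"
    and degs: "image_mset d (mset_set (A \<union> B)) =
      replicate_mset M (M - 1) + replicate_mset N (N - 1)"
    and "0 < N" "N \<le> M"
    and r: "r \<in> A" "d r = M - 1" and "B \<noteq> {}"
    and A: "\<forall>u\<in>A. Suc (d u) \<le> card A" and B: "\<forall>u\<in>B. Suc (d u) \<le> card B"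
  shows "card A = M" "card B = N"
    "\<And>u. u \<in> A \<Longrightarrow> Suc (d u) = card A" "\<And>u. u \<in> B \<Longrightarrow> Suc (d u) = card B"
proof -
  have split: "mset_set (A \<union> B) = mset_set A + mset_set B"
    using fin disj by (rule mset_set_Union)
  have total: "card A + card B = M + N"
    using arg_cong[OF degs, of size] by (simp add: split)
  have low: "N - 1 \<le> d u" if "u \<in> A \<union> B" for u
  proof -
    have "d u \<in># image_mset d (mset_set (A \<union> B))"
      using that fin by simp
    then show ?thesis
      using \<open>N \<le> M\<close> unfolding degs by (auto split: if_splits)
  qed
  obtain b where b: "b \<in> B"
    using \<open>B \<noteq> {}\<close> by blast
  have "M \<le> card A"
    using bspec[OF A r(1)] r(2) \<open>0 < N\<close> \<open>N \<le> M\<close> by simp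
  moreover have "N \<le> card B"
    using bspec[OF B b] low[of b] b \<open>0 < N\<close> by simp
  ultimately show cards: "card A = M" "card B = N"
    using total by simp_all
  have dB: "d u = N - 1" if "u \<in> B" for u
    using bspec[OF B that] low[of u] that cards by simp
  then show "Suc (d u) = card B" if "u \<in> B" for u
    using that cards \<open>0 < N\<close> by simp
  have "image_mset d (mset_set B) = image_mset (\<lambda>_. N - 1) (mset_set B)"
    using fin dB by (intro image_mset_cong) simp
  then have "image_mset d (mset_set B) = replicate_mset N (N - 1)"
    by (simp add: image_mset_const_eq cards)
  then have dA: "image_mset d (mset_set A) = replicate_mset M (M - 1)"
    using degs by (simp add: split)
  show "Suc (d u) = card A" if "u \<in> A" for u
  proof -
    have "d u \<in># image_mset d (mset_set A)"
      using that fin by simp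
    then show ?thesis
      using cards \<open>0 < N\<close> \<open>N \<le> M\<close> unfolding dA by (simp add: in_replicate_mset)
  qed
qed

text \<open>
  That a part is a clique and that no edge leaves it are expressed together: the closed
  neighbourhood of each of its vertices is the whole part. This holds because the closed
  neighbourhood is contained in the part and, by \<open>two_part_degrees\<close>, has the same cardinality.
\<close>

lemma (in graph) disconnected_imp_two_cliques:
  assumes degs: "image_mset (out_degree G) (mset_set (verts G)) =
      replicate_mset M (M - 1) + replicate_mset N (N - 1)"
    and "0 < N" "N \<le> M" and disc: "\<not> connected G"
  obtains A B where "verts G = A \<union> B" "A \<inter> B = {}" "card A = M" "card B = N"
    "\<And>u. u \<in> A \<Longrightarrow> closed_nbhd G u = A" "\<And>u. u \<in> B \<Longrightarrow> closed_nbhd G u = B"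
proof -
  have "M - 1 \<in># image_mset (out_degree G) (mset_set (verts G))"
    using \<open>0 < N\<close> \<open>N \<le> M\<close> unfolding degs by (simp add: in_replicate_mset)
  then obtain r where r: "r \<in> verts G" "out_degree G r = M - 1"
    by auto
  define A where "A = {v. r \<rightarrow>\<^sup>*\<^bsub>G\<^esub> v}"
  define B where "B = verts G - A"
  have part: "verts G = A \<union> B" "A \<inter> B = {}"
    by (auto simp: A_def B_def reachable_in_verts)
  then have fin: "finite A" "finite B"
    using finite_verts by (metis finite_Un)+
  have "r \<in> A"
    using r by (simp add: A_def)
  have "B \<noteq> {}"
  proof
    assume "B = {}"
    then have "r \<rightarrow>\<^sup>*\<^bsub>G\<^esub> v" if "v \<in> verts G" for v
      using that by (auto simp: A_def B_def)
    then have "u \<rightarrow>\<^sup>*\<^bsub>G\<^esub> v" if "u \<in> verts G" "v \<in> verts G" for u v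
      using that by (meson reachable_trans symmetric_reachable')
    then have "connected G"
      using r by (intro connectedI) (auto simp: reachable_mk_symmetric_eq[OF sym_arcs])
    then show False
      using disc by contradiction
  qed
  have A: "closed_nbhd G u \<subseteq> A" if "u \<in> A" for u
    using that reachable_adj_trans by (auto simp: A_def closed_nbhd_def)
  \<comment> \<open>An edge from \<open>B\<close> into \<open>A\<close> could be traversed backwards.\<close>
  have B: "closed_nbhd G u \<subseteq> B" if "u \<in> B" for u
  proof
    fix v assume "v \<in> closed_nbhd G u"
    then consider "v = u" | "u \<rightarrow>\<^bsub>G\<^esub> v"
      by (auto simp: closed_nbhd_def)
    then show "v \<in> B"
    proof cases
      case 2
      then have "v \<rightarrow>\<^bsub>G\<^esub> u" "v \<in> verts G"
        using arcs_ends_symmetric[OF sym_arcs] adj_in_verts by blast+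
      then show ?thesis
        using that reachable_adj_trans by (auto simp: A_def B_def)
    qed (use that in simp)
  qed
  have leA: "\<forall>u\<in>A. Suc (out_degree G u) \<le> card A"
    using card_mono[OF fin(1) A] by (simp add: card_closed_nbhd)
  have leB: "\<forall>u\<in>B. Suc (out_degree G u) \<le> card B"
    using card_mono[OF fin(2) B] by (simp add: card_closed_nbhd)
  note cards = two_part_degrees[OF fin part(2) degs[unfolded part(1)] \<open>0 < N\<close> \<open>N \<le> M\<close>
      \<open>r \<in> A\<close> r(2) \<open>B \<noteq> {}\<close> leA leB]
  show thesis
  proof (rule that[OF part cards(1,2)])
    show "closed_nbhd G u = A" if "u \<in> A" for u
      using card_subset_eq[OF fin(1) A[OF that]] cards(3)[OF that] by (simp add: card_closed_nbhd)
    show "closed_nbhd G u = B" if "u \<in> B" for u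
      using card_subset_eq[OF fin(2) B[OF that]] cards(4)[OF that] by (simp add: card_closed_nbhd)
  qed
qed

section \<open>Isomorphism with the union of two cliques\<close>

text \<open>
  Without parallel arcs an arc is determined by its ends, so a bijection of the vertices that
  preserves adjacency in both directions already determines the map on arcs that
  \<^const>\<open>digraph_iso\<close> asks for.
\<close>

lemma digraph_iso_if_adjacency_bij:
  assumes "nomulti_digraph G" "nomulti_digraph H"
    and bij: "bij_betw f (verts G) (verts H)"
    and adj: "\<And>u v. u \<in> verts G \<Longrightarrow> v \<in> verts G \<Longrightarrow> u \<rightarrow>\<^bsub>G\<^esub> v \<longleftrightarrow> f u \<rightarrow>\<^bsub>H\<^esub> f v"
  shows "digraph_iso G H"
proof -
  interpret G: nomulti_digraph G by fact
  interpret H: nomulti_digraph H by fact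
  define ends where "ends a = (f (tail G a), f (head G a))" for a
  define g where "g a = the_inv_into (arcs H) (arc_to_ends H) (ends a)" for a
  have inj: "inj_on f (verts G)" and im: "f ` verts G = verts H"
    using bij by (auto simp: bij_betw_def)
  have "inj_on ends (arcs G)"
    using inj by (auto intro!: inj_onI G.no_multi_arcs simp: ends_def arc_to_ends_def inj_on_eq_iff)
  moreover have "ends ` arcs G = arcs_ends H"
  proof (intro equalityI subsetI)
    fix e assume "e \<in> ends ` arcs G"
    then obtain a where "a \<in> arcs G" "e = ends a" by blast
    moreover from this have "tail G a \<rightarrow>\<^bsub>G\<^esub> head G a"
      by (auto simp: arcs_ends_conv)
    ultimately show "e \<in> arcs_ends H"
      using adj[of "tail G a" "head G a"] by (simp add: ends_def)
  next
    fix e assume e: "e \<in> arcs_ends H"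
    then have "fst e \<in> f ` verts G" "snd e \<in> f ` verts G"
      using H.adj_in_verts[of "fst e" "snd e"] im by simp_all
    then obtain u v where uv: "u \<in> verts G" "v \<in> verts G" "e = (f u, f v)"
      by (metis imageE prod.collapse)
    then have "u \<rightarrow>\<^bsub>G\<^esub> v"
      using e adj by simp
    then obtain a where "a \<in> arcs G" "tail G a = u" "head G a = v"
      by blast
    then show "e \<in> ends ` arcs G"
      using uv by (auto simp: ends_def)
  qed
  ultimately have "bij_betw ends (arcs G) (arcs_ends H)"
    by (simp add: bij_betw_def)
  moreover have H_ends: "bij_betw (arc_to_ends H) (arcs H) (arcs_ends H)"
    using H.inj_on_arc_to_ends by (simp add: bij_betw_def arcs_ends_def)
  ultimately have g_bij: "bij_betw g (arcs G) (arcs H)"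
    using bij_betw_trans[OF _ bij_betw_the_inv_into, of ends "arcs G" "arcs_ends H"]
    unfolding g_def comp_def by blast
  have g_ends: "arc_to_ends H (g a) = ends a" if "a \<in> arcs G" for a
    unfolding g_def
    using \<open>ends ` arcs G = arcs_ends H\<close> that by (intro f_the_inv_into_f_bij_betw[OF H_ends]) blast
  \<comment> \<open>The head and tail components act on arcs of the image and become its incidence maps, so
    they have to be those of \<open>H\<close>.\<close>
  let ?iso = "\<lparr>iso_verts = f, iso_arcs = g, iso_head = head H, iso_tail = tail H\<rparr>"
  have "pre_digraph.digraph_isomorphism G ?iso"
    unfolding pre_digraph.digraph_isomorphism_def
    using inj g_bij g_ends G.wf_digraph_axioms
    by (auto simp: bij_betw_def ends_def arc_to_ends_def)
  moreover have "H = app_iso ?iso G"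
    using im g_bij by (simp add: app_iso_def bij_betw_def)
  ultimately show ?thesis
    unfolding digraph_iso_def by blast
qed

lemma verts_two_cliques: "verts (two_cliques m n) = Inl ` {..<m} \<union> Inr ` {..<n}"
  by (simp add: two_cliques_def disjoint_union_def complete_graph_def Plus_def)

lemma arcs_ends_complete_graph: "arcs_ends (complete_graph n) = {(u, v). u < n \<and> v < n \<and> u \<noteq> v}"
  by (auto simp: arcs_ends_conv complete_graph_def)

lemma arcs_ends_disjoint_union:
  "arcs_ends (disjoint_union G H) =
    map_prod Inl Inl ` arcs_ends G \<union> map_prod Inr Inr ` arcs_ends H"
  by (simp add: arcs_ends_conv disjoint_union_def Plus_def image_Un image_image)

lemma adj_two_cliques:
  "Inl i \<rightarrow>\<^bsub>two_cliques m n\<^esub> Inl j \<longleftrightarrow> i < m \<and> j < m \<and> i \<noteq> j"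
  "Inr i \<rightarrow>\<^bsub>two_cliques m n\<^esub> Inr j \<longleftrightarrow> i < n \<and> j < n \<and> i \<noteq> j"
  "\<not> Inl i \<rightarrow>\<^bsub>two_cliques m n\<^esub> Inr j" "\<not> Inr j \<rightarrow>\<^bsub>two_cliques m n\<^esub> Inl i"
  by (auto simp: two_cliques_def arcs_ends_disjoint_union arcs_ends_complete_graph)

lemma (in graph) two_cliques_iso:
  assumes part: "verts G = A \<union> B" "A \<inter> B = {}" and "card A = m" "card B = n"
    and A: "\<And>u. u \<in> A \<Longrightarrow> closed_nbhd G u = A" and B: "\<And>u. u \<in> B \<Longrightarrow> closed_nbhd G u = B"
  shows "digraph_iso G (two_cliques m n)"
proof -
  interpret H: graph "two_cliques m n" by (rule graph_two_cliques)
  have fin: "finite A" "finite B"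
    using part finite_verts by (metis finite_Un)+
  obtain f where f: "bij_betw f A {..<m}"
    using ex_bij_betw_finite_nat[OF fin(1)] \<open>card A = m\<close> by (auto simp: atLeast0LessThan)
  obtain g where g: "bij_betw g B {..<n}"
    using ex_bij_betw_finite_nat[OF fin(2)] \<open>card B = n\<close> by (auto simp: atLeast0LessThan)
  define h where "h u = (if u \<in> A then Inl (f u) else Inr (g u))" for u
  have fm: "f u < m" if "u \<in> A" for u
    using that f by (auto simp: bij_betw_def)
  have gn: "g u < n" if "u \<in> B" for u
    using that g by (auto simp: bij_betw_def)
  have hA: "h u = Inl (f u)" if "u \<in> A" for u
    using that by (simp add: h_def)
  have hB: "h u = Inr (g u)" if "u \<in> B" for u
    using that part(2) by (auto simp: h_def)
  have f_eq: "f u = f v \<longleftrightarrow> u = v" if "u \<in> A" "v \<in> A" for u v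
    using that f by (auto simp: bij_betw_def dest: inj_onD)
  have g_eq: "g u = g v \<longleftrightarrow> u = v" if "u \<in> B" "v \<in> B" for u v
    using that g by (auto simp: bij_betw_def dest: inj_onD)
  have adj_iff: "u \<rightarrow>\<^bsub>G\<^esub> v \<longleftrightarrow> v \<noteq> u \<and> v \<in> closed_nbhd G u" for u v
    using adj_not_same by (auto simp: closed_nbhd_def)
  show ?thesis
  proof (rule digraph_iso_if_adjacency_bij[where f = h])
    show "bij_betw h (verts G) (verts (two_cliques m n))"
    proof -
      have "h ` A = Inl ` f ` A" "h ` B = Inr ` g ` B"
        unfolding image_image by (simp_all add: hA hB cong: image_cong)
      then have "h ` verts G = verts (two_cliques m n)"
        using f g by (simp add: part(1) verts_two_cliques image_Un bij_betw_def)
      moreover have "inj_on h (verts G)"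
        using hA hB f_eq g_eq by (auto simp: part(1) intro!: inj_onI)
      ultimately show ?thesis
        by (simp add: bij_betw_def)
    qed
  next
    fix u v assume "u \<in> verts G" "v \<in> verts G"
    then show "u \<rightarrow>\<^bsub>G\<^esub> v \<longleftrightarrow> h u \<rightarrow>\<^bsub>two_cliques m n\<^esub> h v"
      using part(2) by (auto simp: adj_iff part(1) hA hB A B adj_two_cliques fm gn f_eq g_eq)
  qed unfold_locales
qed

section \<open>Connectedness\<close>

theorem proposition2:
  fixes G :: "('a, 'b) pre_digraph" and m n :: nat
  assumes "m > 0" and "n > 0"
    and "G \<in> degree_class m n"
  shows "Digraph_Component.connected G"
proof (rule ccontr)
  assume disc: "\<not> Digraph_Component.connected G"
  have "graph G" and seq: "degree_sequence G = degree_sequence (two_cliques m n)"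
    and not_iso: "\<not> digraph_iso G (two_cliques m n)"
    using assms(3) by (auto simp: degree_class_def)
  interpret graph G by fact
  have degs: "image_mset (out_degree G) (mset_set (verts G)) =
      replicate_mset m (m - 1) + replicate_mset n (n - 1)"
    using arg_cong[OF seq, of mset] unfolding mset_degree_sequence_two_cliques
    by (simp add: degree_sequence_def)
  \<comment> \<open>The two clique sizes play symmetric roles; the larger one goes first.\<close>
  show False
  proof (cases "n \<le> m")
    case True
    show False
      by (rule disconnected_imp_two_cliques[OF degs \<open>0 < n\<close> True disc])
        (use two_cliques_iso not_iso in blast)
  next
    case False
    have "image_mset (out_degree G) (mset_set (verts G)) =
        replicate_mset n (n - 1) + replicate_mset m (m - 1)"
      using degs by (simp add: add.commute)
    moreover from False have "m \<le> n" by simp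
    ultimately show False
      by (rule disconnected_imp_two_cliques[OF _ \<open>0 < m\<close> _ disc])
        (metis two_cliques_iso not_iso Un_commute Int_commute)
  qed
qed

end
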